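(* Let $\Omega\subset\mathbb{H}$ be an st-domain and let $f,g:\Omega\to\mathbb{H}$ be two slice regular functions. If there is some $I\in\mathbb{S}$ such that $f$ and $g$ coincide on a subset of $\Omega_I$ having an accumulation point in $\Omega_I$, then $f=g$ on $\Omega$.
   Context: $\mathbb{H}$ denotes the quaternions and $\mathbb{S}=\{q\in\mathbb{H}: q^2=-1\}$. For $I\in\mathbb{S}$, $\mathbb{C}_I=\mathbb{R}+I\mathbb{R}$ with its Euclidean topology, and for $\Omega\subset\mathbb{H}$, $\Omega_I:=\Omega\cap\mathbb{C}_I$ and $f_I:=f|_{\Omega_I}$. A set $\Omega\subset\mathbb{H}$ is slice-open if $\Omega_I$ is open in $\mathbb{C}_I$ for every $I\in\mathbb{S}$; the slice-open sets form a topology $\tau_s$ on $\mathbb{H}$, the slice topology. An st-domain is a domain in the slice topology, i.e. a slice-open set that is connected in the slice topology. For $U$ open in $\mathbb{C}_I$, a function $h:U\to\mathbb{H}$ is (left $\mathbb{C}_I$-)holomorphic if it has continuous partial derivatives and $\frac12\left(\frac{\partial}{\partial x}+I\frac{\partial}{\partial y}\right)h(x+yI)=0$ for all $x,y\in\mathbb{R}$ with $x+yI\in U$. A function $f:\Omega\to\mathbb{H}$ on a slice-open set $\Omega$ is slice regular if $f_I$ is left $\mathbb{C}_I$-holomorphic for every $I\in\mathbb{S}$. *)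

theory Defs
  imports "HOL-Analysis.Analysis"
begin

section \<open>Quaternions\<close>

datatype quat = Quat (qre: real) (qi: real) (qj: real) (qk: real)

lemma quat_eq_iff: "p = q \<longleftrightarrow> qre p = qre q \<and> qi p = qi q \<and> qj p = qj q \<and> qk p = qk q"
  by (cases p; cases q) auto

instantiation quat :: real_vector
begin

definition "0 = Quat 0 0 0 0"
definition "p + q = Quat (qre p + qre q) (qi p + qi q) (qj p + qj q) (qk p + qk q)"
definition "- p = Quat (- qre p) (- qi p) (- qj p) (- qk p)"
definition "p - q = Quat (qre p - qre q) (qi p - qi q) (qj p - qj q) (qk p - qk q)"
definition "r *\<^sub>R p = Quat (r * qre p) (r * qi p) (r * qj p) (r * qk p)"

instance
  by standard
    (simp_all add: quat_eq_iff zero_quat_def plus_quat_def uminus_quat_def minus_quat_def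
      scaleR_quat_def algebra_simps)

end

lemma quat_linear_simps [simp]:
  "qre 0 = 0" "qi 0 = 0" "qj 0 = 0" "qk 0 = 0"
  "qre (p + q) = qre p + qre q" "qi (p + q) = qi p + qi q"
  "qj (p + q) = qj p + qj q" "qk (p + q) = qk p + qk q"
  "qre (- p) = - qre p" "qi (- p) = - qi p" "qj (- p) = - qj p" "qk (- p) = - qk p"
  "qre (p - q) = qre p - qre q" "qi (p - q) = qi p - qi q"
  "qj (p - q) = qj p - qj q" "qk (p - q) = qk p - qk q"
  "qre (r *\<^sub>R p) = r * qre p" "qi (r *\<^sub>R p) = r * qi p"
  "qj (r *\<^sub>R p) = r * qj p" "qk (r *\<^sub>R p) = r * qk p"
  by (simp_all add: zero_quat_def plus_quat_def uminus_quat_def minus_quat_def scaleR_quat_def)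

text \<open>The Euclidean structure of \<open>\<real>\<^sup>4\<close>; \<open>open\<close>, \<open>dist\<close> and \<open>norm\<close> on quaternions are Euclidean.\<close>

instantiation quat :: real_inner
begin

definition "inner p q = qre p * qre q + qi p * qi q + qj p * qj q + qk p * qk q"
definition "norm (p :: quat) = sqrt (inner p p)"
definition "dist (p :: quat) q = norm (p - q)"
definition "sgn (p :: quat) = p /\<^sub>R norm p"
definition uniformity_quat :: "(quat \<times> quat) filter"
  where "uniformity_quat = (INF e\<in>{0<..}. principal {(p, q). dist p q < e})"
definition open_quat :: "quat set \<Rightarrow> bool"
  where "open_quat U \<longleftrightarrow> (\<forall>p\<in>U. eventually (\<lambda>(p', q). p' = p \<longrightarrow> q \<in> U) uniformity)"

instance
proof
  fix p :: quat
  show "0 \<le> inner p p"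
    by (simp add: inner_quat_def)
  show "inner p p = 0 \<longleftrightarrow> p = 0"
    unfolding inner_quat_def quat_eq_iff
    by (auto simp: add_nonneg_eq_0_iff)
  fix q r :: quat and a :: real
  show "inner p q = inner q p"
    by (simp add: inner_quat_def mult.commute)
  show "inner (p + q) r = inner p r + inner q r" "inner (a *\<^sub>R p) q = a * inner p q"
    by (simp_all add: inner_quat_def algebra_simps)
qed (fact dist_quat_def sgn_quat_def uniformity_quat_def open_quat_def norm_quat_def)+

end

instantiation quat :: euclidean_space
begin

definition "Basis = {Quat 1 0 0 0, Quat 0 1 0 0, Quat 0 0 1 0, Quat 0 0 0 1}"

instance
proof
  fix p u v :: quat
  show "u \<in> Basis \<Longrightarrow> v \<in> Basis \<Longrightarrow> inner u v = (if u = v then 1 else 0)"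
    unfolding Basis_quat_def by (elim insertE emptyE; simp add: inner_quat_def)
  show "(\<forall>u\<in>Basis. inner p u = 0) \<longleftrightarrow> p = 0"
    by (cases p) (simp add: Basis_quat_def inner_quat_def zero_quat_def)
qed (simp_all add: Basis_quat_def)

end

instantiation quat :: real_algebra_1
begin

definition "1 = Quat 1 0 0 0"
definition "p * q = Quat
  (qre p * qre q - qi p * qi q - qj p * qj q - qk p * qk q)
  (qre p * qi q + qi p * qre q + qj p * qk q - qk p * qj q)
  (qre p * qj q - qi p * qk q + qj p * qre q + qk p * qi q)
  (qre p * qk q + qi p * qj q - qj p * qi q + qk p * qre q)"

instance
proof
  fix p q r :: quat and a :: real
  show "p * q * r = p * (q * r)"
    by (simp add: quat_eq_iff times_quat_def algebra_simps)
  show "1 * p = p" "p * 1 = p"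
    by (simp_all add: quat_eq_iff times_quat_def one_quat_def)
  show "(p + q) * r = p * r + q * r" "p * (q + r) = p * q + p * r"
    by (simp_all add: quat_eq_iff times_quat_def algebra_simps)
  show "(0 :: quat) \<noteq> 1"
    by (simp add: quat_eq_iff one_quat_def)
  show "a *\<^sub>R p * q = a *\<^sub>R (p * q)" "p * a *\<^sub>R q = a *\<^sub>R (p * q)"
    by (simp_all add: quat_eq_iff times_quat_def algebra_simps)
qed

end

instantiation quat :: real_normed_div_algebra
begin

definition "inverse p = Quat (qre p) (- qi p) (- qj p) (- qk p) /\<^sub>R inner p p"
definition "divide p q = p * inverse (q :: quat)"

instance
proof
  fix p q :: quat
  have inv: "p * inverse p = 1 \<and> inverse p * p = 1" if "p \<noteq> 0"
  proof -
    define r where "r = inverse (inner p p)"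
    have "inner p p \<noteq> 0" using that by simp
    then have "r * (qre p * qre p + qi p * qi p + qj p * qj p + qk p * qk p) = 1"
      by (simp add: r_def inner_quat_def)
    moreover have "inverse p = Quat (r * qre p) (- r * qi p) (- r * qj p) (- r * qk p)"
      by (simp add: inverse_quat_def r_def quat_eq_iff)
    ultimately show ?thesis
      by (simp add: quat_eq_iff times_quat_def one_quat_def algebra_simps)
  qed
  then show "p \<noteq> 0 \<Longrightarrow> inverse p * p = 1" "p \<noteq> 0 \<Longrightarrow> p * inverse p = 1"
    by auto
  show "inverse (0 :: quat) = 0"
    by (simp add: inverse_quat_def quat_eq_iff)
  show "divide p q = p * inverse q"
    by (fact divide_quat_def)
  show "norm (p * q) = norm p * norm q"
    unfolding norm_quat_def inner_quat_def times_quat_def real_sqrt_mult [symmetric]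
    by (simp add: algebra_simps)
qed

end


section \<open>Slices and the slice topology\<close>

definition imag_units :: "quat set"
  where "imag_units = {q. q\<^sup>2 = - 1}"

definition slice_plane :: "quat \<Rightarrow> quat set"
  where "slice_plane I = {of_real x + of_real y * I | x y. True}"

definition slice_open :: "quat set \<Rightarrow> bool"
  where "slice_open \<Omega> \<longleftrightarrow>
    (\<forall>I\<in>imag_units. openin (top_of_set (slice_plane I)) (\<Omega> \<inter> slice_plane I))"

lemma istopology_slice_open: "istopology slice_open"
  unfolding istopology_def
proof (intro conjI allI impI)
  fix S T assume S: "slice_open S" and T: "slice_open T"
  show "slice_open (S \<inter> T)"
    unfolding slice_open_def
  proof
    fix I assume "I \<in> imag_units"
    then have "openin (top_of_set (slice_plane I)) ((S \<inter> slice_plane I) \<inter> (T \<inter> slice_plane I))"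
      using S T by (simp add: slice_open_def openin_Int)
    then show "openin (top_of_set (slice_plane I)) (S \<inter> T \<inter> slice_plane I)"
      by (simp add: inf_sup_aci)
  qed
next
  fix \<K> assume \<K>: "\<forall>K\<in>\<K>. slice_open K"
  show "slice_open (\<Union>\<K>)"
    unfolding slice_open_def
  proof
    fix I assume "I \<in> imag_units"
    then have "openin (top_of_set (slice_plane I)) (\<Union>K\<in>\<K>. K \<inter> slice_plane I)"
      using \<K> by (intro openin_Union) (auto simp: slice_open_def)
    then show "openin (top_of_set (slice_plane I)) (\<Union>\<K> \<inter> slice_plane I)"
      by (simp only: Int_Union2)
  qed
qed

definition slice_topology :: "quat topology"
  where "slice_topology = topology slice_open"

lemma openin_slice_topology: "openin slice_topology = slice_open"
  unfolding slice_topology_def by (rule topology_inverse' [OF istopology_slice_open])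

lemma topspace_slice_topology: "topspace slice_topology = UNIV"
proof -
  have "slice_open UNIV"
    by (simp add: slice_open_def)
  then show ?thesis
    by (metis openin_slice_topology openin_subset top.extremum_uniqueI)
qed

definition st_domain :: "quat set \<Rightarrow> bool"
  where "st_domain \<Omega> \<longleftrightarrow> openin slice_topology \<Omega> \<and> connectedin slice_topology \<Omega>"


section \<open>Slice regular functions\<close>

text \<open>
  The functions \<open>h\<^sub>x\<close>, \<open>h\<^sub>y\<close> are the partial derivatives of \<open>(x, y) \<mapsto> h (x + y I)\<close>, defined on the
  set of coordinates of points of \<open>U\<close>. Only the values of \<open>h\<close> on \<open>U\<close> matter when \<open>U\<close> is open in
  \<open>slice_plane I\<close>. The unit \<open>I\<close> multiplies from the left.
\<close>

definition slice_holomorphic_on :: "quat \<Rightarrow> (quat \<Rightarrow> quat) \<Rightarrow> quat set \<Rightarrow> bool"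
  where "slice_holomorphic_on I h U \<longleftrightarrow>
    (\<exists>h\<^sub>x h\<^sub>y :: real \<times> real \<Rightarrow> quat.
      continuous_on {(x, y). of_real x + of_real y * I \<in> U} h\<^sub>x \<and>
      continuous_on {(x, y). of_real x + of_real y * I \<in> U} h\<^sub>y \<and>
      (\<forall>x y. of_real x + of_real y * I \<in> U \<longrightarrow>
        ((\<lambda>t. h (of_real t + of_real y * I)) has_vector_derivative h\<^sub>x (x, y)) (at x) \<and>
        ((\<lambda>t. h (of_real x + of_real t * I)) has_vector_derivative h\<^sub>y (x, y)) (at y) \<and>
        (1 / 2) *\<^sub>R (h\<^sub>x (x, y) + I * h\<^sub>y (x, y)) = 0))"

definition slice_regular_on :: "(quat \<Rightarrow> quat) \<Rightarrow> quat set \<Rightarrow> bool"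
  where "slice_regular_on f \<Omega> \<longleftrightarrow>
    slice_open \<Omega> \<and> (\<forall>I\<in>imag_units. slice_holomorphic_on I f (\<Omega> \<inter> slice_plane I))"

end

theory Submission
  imports Defs "HOL-Complex_Analysis.Complex_Analysis"
begin

text \<open>
  Left multiplication by \<open>I\<close> makes the quaternions a complex vector space, and a slice regular
  function restricted to the slice of \<open>I\<close> is holomorphic with values in that space; composing it
  with complex linear functionals reduces local statements to the classical identity theorem.
  Globally, consider the points of \<open>\<Omega>\<close> near which \<open>f - g\<close> vanishes in \<^emph>\<open>every\<close> slice through the
  point. A nonreal point lies on a single slice; at a real point, vanishing in one slice gives
  vanishing on a real interval, hence in all slices. Therefore this set and its complement in \<open>\<Omega>\<close>
  are both slice-open.
\<close>

section \<open>Geometry of the slices\<close>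

text \<open>Coordinates on the slice of \<open>I\<close> by \<open>complex\<close>, so that
  classical complex analysis can be applied to functions on the slice.\<close>

definition slice_embed :: "quat \<Rightarrow> complex \<Rightarrow> quat"
  where "slice_embed I z = of_real (Re z) + of_real (Im z) * I"

lemma slice_plane_eq_range: "slice_plane I = range (slice_embed I)"
proof -
  have "of_real x + of_real y * I \<in> range (slice_embed I)" for x y
    by (rule range_eqI [of _ _ "Complex x y"]) (simp add: slice_embed_def)
  then show ?thesis
    by (auto simp: slice_plane_def slice_embed_def)
qed

lemma quat_of_real_eq: "(of_real x :: quat) = Quat x 0 0 0"
  by (simp add: of_real_def quat_eq_iff one_quat_def)

lemma imag_units_sq: "I \<in> imag_units \<Longrightarrow> I * I = - 1"
  by (simp add: imag_units_def power2_eq_square)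

text \<open>The imaginary components of \<open>I * I = - 1\<close> are twice \<open>qre I\<close>
  times those of \<open>I\<close>. Were \<open>qre I\<close> nonzero, \<open>I\<close> would be a
  real number with negative square.\<close>

lemma qre_imag_unit:
  assumes "I \<in> imag_units"
  shows "qre I = 0"
proof (rule ccontr)
  assume ne: "qre I \<noteq> 0"
  have "qre I * qre I - qi I * qi I - qj I * qj I - qk I * qk I = - 1"
    "qre I * qi I = 0" "qre I * qj I = 0" "qre I * qk I = 0"
    using imag_units_sq [OF assms] by (auto simp: quat_eq_iff times_quat_def one_quat_def)
  with ne have "qre I * qre I = - 1"
    by simp
  then show False
    by (smt (verit) zero_le_square)
qed

lemma norm_imag_unit:
  assumes "I \<in> imag_units"
  shows "norm I = 1"
proof -
  have "(norm I)\<^sup>2 = 1"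
    using assms by (simp add: imag_units_def flip: norm_power)
  then show ?thesis
    by (simp add: power2_eq_1_iff) (smt (verit) norm_ge_zero)
qed

text \<open>For an imaginary unit \<open>I\<close>, the pair \<open>1\<close>, \<open>I\<close> is
  orthonormal, so \<open>slice_embed I\<close> is isometric.\<close>

lemma norm_slice_embed:
  assumes "I \<in> imag_units"
  shows "norm (slice_embed I z) = norm z"
proof -
  have "qi I * qi I + qj I * qj I + qk I * qk I = 1"
    using norm_imag_unit [OF assms] qre_imag_unit [OF assms]
    by (simp add: norm_quat_def inner_quat_def)
  moreover have "inner (slice_embed I z) (slice_embed I z)
      = (Re z)\<^sup>2 + (Im z)\<^sup>2 * (qi I * qi I + qj I * qj I + qk I * qk I)"
    using qre_imag_unit [OF assms]
    by (simp add: slice_embed_def inner_quat_def quat_of_real_eq times_quat_def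
        power2_eq_square algebra_simps)
  ultimately show ?thesis
    by (simp add: norm_quat_def cmod_def)
qed

lemma slice_embed_diff: "slice_embed I z - slice_embed I w = slice_embed I (z - w)"
  by (simp add: slice_embed_def algebra_simps)

lemma dist_slice_embed:
  "I \<in> imag_units \<Longrightarrow> dist (slice_embed I z) (slice_embed I w) = dist z w"
  by (simp add: dist_norm slice_embed_diff norm_slice_embed)

lemma continuous_on_slice_embed: "continuous_on S (slice_embed I)"
  unfolding slice_embed_def by (intro continuous_intros)

lemma open_vimage_slice_embed:
  assumes "openin (top_of_set (slice_plane I)) U"
  shows "open (slice_embed I -` U)"
proof -
  have "openin (top_of_set UNIV) (UNIV \<inter> slice_embed I -` U)"
    using assms
    by (rule continuous_openin_preimage [OF continuous_on_slice_embed, rotated])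
      (simp add: slice_plane_eq_range)
  then show ?thesis
    by simp
qed

lemma of_real_mem_slice_plane: "of_real x \<in> slice_plane I"
proof -
  have "of_real x = of_real x + of_real 0 * I"
    by simp
  then show ?thesis
    unfolding slice_plane_def by blast
qed

lemma add_of_real_mem_slice_plane:
  assumes "q \<in> slice_plane I"
  shows "q + of_real t \<in> slice_plane I"
proof -
  obtain x y where "q = of_real x + of_real y * I"
    using assms by (auto simp: slice_plane_def)
  then have "q + of_real t = of_real (x + t) + of_real y * I"
    by simp
  then show ?thesis
    unfolding slice_plane_def by blast
qed

text \<open>For nonreal \<open>q\<close> the unit is the normalized imaginary part; for real
  \<open>q\<close> any unit works.\<close>

lemma quat_in_some_slice_plane: "\<exists>I\<in>imag_units. q \<in> slice_plane I"
proof (cases "q \<in> \<real>")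
  case True
  have "Quat 0 1 0 0 \<in> imag_units"
    by (simp add: imag_units_def power2_eq_square times_quat_def one_quat_def quat_eq_iff)
  with True show ?thesis
    by (auto elim!: Reals_cases intro: of_real_mem_slice_plane)
next
  case False
  define n where "n = sqrt ((qi q)\<^sup>2 + (qj q)\<^sup>2 + (qk q)\<^sup>2)"
  have "n \<noteq> 0"
  proof
    assume "n = 0"
    then have "(qi q)\<^sup>2 + (qj q)\<^sup>2 + (qk q)\<^sup>2 = 0"
      by (simp add: n_def)
    then have "qi q = 0" "qj q = 0" "qk q = 0"
      by (smt (verit) zero_le_power2 power2_eq_iff_nonneg zero_eq_power2)+
    then have "q = of_real (qre q)"
      by (simp add: quat_eq_iff quat_of_real_eq)
    with False show False
      by (metis Reals_of_real)
  qed
  have n2: "n * n = qi q * qi q + qj q * qj q + qk q * qk q"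
    by (simp add: n_def power2_eq_square)
  define I where "I = Quat 0 (qi q / n) (qj q / n) (qk q / n)"
  have "(qi q * qi q + qj q * qj q + qk q * qk q) / (n * n) = 1"
    using \<open>n \<noteq> 0\<close> by (simp flip: n2)
  then have "I \<in> imag_units"
    by (simp add: I_def imag_units_def power2_eq_square times_quat_def one_quat_def quat_eq_iff
        add_divide_distrib)
  moreover have "q = of_real (qre q) + of_real n * I"
    using \<open>n \<noteq> 0\<close> by (simp add: I_def quat_eq_iff quat_of_real_eq times_quat_def)
  ultimately show ?thesis
    unfolding slice_plane_def by blast
qed

lemma slice_plane_uminus: "slice_plane (- I) = slice_plane I"
proof -
  have "slice_plane (- J) \<subseteq> slice_plane J" for J
  proof
    fix q assume "q \<in> slice_plane (- J)"
    then obtain x y where "q = of_real x + of_real (- y) * J"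
      by (auto simp: slice_plane_def)
    then show "q \<in> slice_plane J"
      unfolding slice_plane_def by blast
  qed
  from this [of I] this [of "- I"] show ?thesis
    by auto
qed

text \<open>Imaginary units have real part zero, so comparing real parts leaves
  \<open>y *\<^sub>R I = y' *\<^sub>R J\<close> with \<open>y\<close> nonzero. Taking norms gives
  \<open>y' = y\<close> or \<open>y' = - y\<close>, hence \<open>I = J\<close> or
  \<open>I = - J\<close>, and opposite units span the same plane.\<close>

lemma slice_plane_eq_if_common_nonreal:
  assumes I: "I \<in> imag_units" and J: "J \<in> imag_units"
    and qI: "q \<in> slice_plane I" and qJ: "q \<in> slice_plane J" and "q \<notin> \<real>"
  shows "slice_plane I = slice_plane J"
proof -
  obtain x y where q: "q = of_real x + of_real y * I"
    using qI by (auto simp: slice_plane_def)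
  obtain x' y' where q': "q = of_real x' + of_real y' * J"
    using qJ by (auto simp: slice_plane_def)
  have "qre (of_real a + of_real b * K) = a" if "K \<in> imag_units" for a b K
    using qre_imag_unit [OF that] by (simp add: quat_of_real_eq times_quat_def)
  then have "x = x'"
    using q q' I J by metis
  then have eq: "y *\<^sub>R I = y' *\<^sub>R J"
    using q q' by (simp add: scaleR_conv_of_real)
  then have "norm (y *\<^sub>R I) = norm (y' *\<^sub>R J)"
    by simp
  then have "\<bar>y\<bar> = \<bar>y'\<bar>"
    by (simp add: norm_imag_unit I J)
  moreover have "y \<noteq> 0"
    using q \<open>q \<notin> \<real>\<close> by auto
  ultimately consider "y' = y" | "y' = - y"
    by linarith
  then have "I = J \<or> I = - J"
    by cases (use eq \<open>y \<noteq> 0\<close> in \<open>auto simp flip: scaleR_minus_right\<close>)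
  then show ?thesis
    by (auto simp: slice_plane_uminus)
qed

text \<open>A real translate of \<open>q\<close> stays in every slice plane through
  \<open>q\<close>, so a segment of zeros in the real direction is visible from each of these
  slices.\<close>

lemma islimpt_of_real_shifts:
  fixes q :: quat
  assumes "0 < e" and "\<And>t. \<bar>t\<bar> < e \<Longrightarrow> q + of_real t \<in> Z"
  shows "q islimpt Z"
  unfolding islimpt_approachable
proof (intro allI impI)
  fix d :: real assume "0 < d"
  define t where "t = min d e / 2"
  have t: "0 < t" "t < d" "t < e"
    using \<open>0 < d\<close> \<open>0 < e\<close> by (auto simp: t_def)
  then show "\<exists>z\<in>Z. z \<noteq> q \<and> dist z q < d"
    using assms(2) [of t] by (intro bexI [of _ "q + of_real t"]) (auto simp: dist_norm)
qed

section \<open>The identity theorem on a slice\<close>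

lemma slice_holomorphic_on_diff:
  assumes "slice_holomorphic_on I f U" and "slice_holomorphic_on I g U"
  shows "slice_holomorphic_on I (\<lambda>q. f q - g q) U"
proof -
  obtain fx fy where f: "continuous_on {(x, y). of_real x + of_real y * I \<in> U} fx"
    "continuous_on {(x, y). of_real x + of_real y * I \<in> U} fy"
    "\<And>x y. of_real x + of_real y * I \<in> U \<Longrightarrow>
        ((\<lambda>t. f (of_real t + of_real y * I)) has_vector_derivative fx (x, y)) (at x) \<and>
        ((\<lambda>t. f (of_real x + of_real t * I)) has_vector_derivative fy (x, y)) (at y) \<and>
        (1 / 2) *\<^sub>R (fx (x, y) + I * fy (x, y)) = 0"
    using assms(1) unfolding slice_holomorphic_on_def by blast
  obtain gx gy where g: "continuous_on {(x, y). of_real x + of_real y * I \<in> U} gx"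
    "continuous_on {(x, y). of_real x + of_real y * I \<in> U} gy"
    "\<And>x y. of_real x + of_real y * I \<in> U \<Longrightarrow>
        ((\<lambda>t. g (of_real t + of_real y * I)) has_vector_derivative gx (x, y)) (at x) \<and>
        ((\<lambda>t. g (of_real x + of_real t * I)) has_vector_derivative gy (x, y)) (at y) \<and>
        (1 / 2) *\<^sub>R (gx (x, y) + I * gy (x, y)) = 0"
    using assms(2) unfolding slice_holomorphic_on_def by blast
  have cr: "(1 / 2) *\<^sub>R ((fx p - gx p) + I * (fy p - gy p)) = 0"
    if "(1 / 2) *\<^sub>R (fx p + I * fy p) = 0" "(1 / 2) *\<^sub>R (gx p + I * gy p) = 0" for p
  proof -
    have eq: "(fx p - gx p) + I * (fy p - gy p) = (fx p + I * fy p) - (gx p + I * gy p)"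
      by (simp add: algebra_simps)
    show ?thesis
      unfolding eq using that by simp
  qed
  show ?thesis
    unfolding slice_holomorphic_on_def
    by (rule exI [of _ "\<lambda>p. fx p - gx p"], rule exI [of _ "\<lambda>p. fy p - gy p"])
      (use f g cr in \<open>auto intro!: continuous_on_diff has_vector_derivative_diff\<close>)
qed

text \<open>
  The functional \<open>q \<mapsto> \<langle>q, v\<rangle> - i \<langle>I q, v\<rangle>\<close> is complex linear for the structure given by left
  multiplication by \<open>I\<close>.
\<close>

definition slice_functional :: "quat \<Rightarrow> quat \<Rightarrow> quat \<Rightarrow> complex"
  where "slice_functional I v q = Complex (inner q v) (- inner (I * q) v)"

lemma bounded_linear_slice_functional: "bounded_linear (slice_functional I v)"
proof -
  have "slice_functional I v = (\<lambda>q. of_real (inner q v) - \<i> * of_real (inner (I * q) v))"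
    by (auto simp: slice_functional_def complex_eq_iff)
  moreover have "bounded_linear \<dots>"
    by (intro bounded_linear_sub bounded_linear_const_mult
        bounded_linear_compose [OF bounded_linear_of_real]
        bounded_linear_compose [OF bounded_linear_inner_left]
        bounded_linear_ident bounded_linear_mult_right)
  ultimately show ?thesis
    by simp
qed

lemma slice_functional_unit_mult:
  assumes "I \<in> imag_units"
  shows "slice_functional I v (I * q) = \<i> * slice_functional I v q"
proof -
  have "I * (I * q) = - q"
    using imag_units_sq [OF assms] by (simp flip: mult.assoc)
  then show ?thesis
    by (simp add: slice_functional_def complex_eq_iff)
qed

text \<open>Continuous partial derivatives give a total real derivative. The Cauchy-Riemann equation
  for \<open>h\<close> and the complex linearity of the functional then turn this derivative into
  multiplication by a complex number.\<close>

lemma holomorphic_on_slice_functional: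
  assumes I: "I \<in> imag_units" and U: "openin (top_of_set (slice_plane I)) U"
    and h: "slice_holomorphic_on I h U"
  shows "(\<lambda>z. slice_functional I v (h (slice_embed I z))) holomorphic_on (slice_embed I -` U)"
proof -
  let ?W = "{(x, y). of_real x + of_real y * I \<in> U}"
  let ?\<phi> = "slice_functional I v"
  define H where "H x y = h (of_real x + of_real y * I)" for x y
  obtain hx hy where cont: "continuous_on ?W hy"
    and dx: "\<And>x y. (x, y) \<in> ?W \<Longrightarrow> ((\<lambda>t. H t y) has_vector_derivative hx (x, y)) (at x)"
    and dy: "\<And>x y. (x, y) \<in> ?W \<Longrightarrow> (H x has_vector_derivative hy (x, y)) (at y)"
    and cr: "\<And>x y. (x, y) \<in> ?W \<Longrightarrow> hx (x, y) + I * hy (x, y) = 0"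
    using h unfolding slice_holomorphic_on_def H_def by fastforce
  have "?W = (\<lambda>p. Complex (fst p) (snd p)) -` (slice_embed I -` U)"
    by (auto simp: slice_embed_def)
  moreover have "continuous_on UNIV (\<lambda>p. Complex (fst p) (snd p))"
    by (intro continuous_intros)
  ultimately have "open ?W"
    using open_vimage [OF open_vimage_slice_embed [OF U]] by simp
  have "\<exists>D. ((\<lambda>z. ?\<phi> (h (slice_embed I z))) has_field_derivative D) (at z)"
    if "slice_embed I z \<in> U" for z
  proof -
    define a b where "a = hx (Re z, Im z)" and "b = hy (Re z, Im z)"
    have z: "(Re z, Im z) \<in> ?W"
      using that by (simp add: slice_embed_def)
    obtain A B where AB: "open A" "open B" "(Re z, Im z) \<in> A \<times> B" "A \<times> B \<subseteq> ?W"
      using open_prod_elim [OF \<open>open ?W\<close> z] .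
    then obtain e where e: "0 < e" "ball (Im z) e \<subseteq> B"
      using openE by blast
    \<comment> \<open>The rule on partial derivatives asks for a convex second factor, hence the
      shrinking of \<open>B\<close> to a ball.\<close>
    define Y where "Y = ball (Im z) e"
    have Y: "open Y" "convex Y" "Im z \<in> Y" "A \<times> Y \<subseteq> ?W"
      using e AB by (auto simp: Y_def)
    \<comment> \<open>The rule takes the derivative in \<open>y\<close> as a bounded linear operator
      depending continuously on the point, so \<open>hy\<close> is wrapped in
      \<open>blinfun_scaleR_left\<close>.\<close>
    have "((\<lambda>(x, y). H x y) has_derivative
        (\<lambda>(s, t). s *\<^sub>R a + blinfun_apply (blinfun_scaleR_left (hy (Re z, Im z))) t))
        (at (Re z, Im z) within A \<times> Y)"
    proof (rule has_derivative_partialsI)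
      show "((\<lambda>x. H x (Im z)) has_derivative (\<lambda>s. s *\<^sub>R a)) (at (Re z) within A)"
        using dx [OF z] unfolding a_def has_vector_derivative_def
        by (rule has_derivative_at_withinI)
      show "(H x has_derivative blinfun_apply (blinfun_scaleR_left (hy (x, y)))) (at y within Y)"
        if "x \<in> A" "y \<in> Y" for x y
        using dy [of x y] Y(4) that unfolding has_vector_derivative_def
        by (auto intro: has_derivative_at_withinI)
      have "continuous_on (A \<times> Y) (\<lambda>p. blinfun_scaleR_left (hy p))"
        by (intro continuous_intros continuous_on_subset [OF cont] Y)
      then show "continuous (at (Re z, Im z) within A \<times> Y)
          (\<lambda>(x, y). blinfun_scaleR_left (hy (x, y)))"
        using AB Y by (simp add: continuous_on_eq_continuous_within case_prod_unfold)
    qed (use Y in auto)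
    moreover have "at (Re z, Im z) within A \<times> Y = at (Re z, Im z)"
      using AB Y by (intro at_within_open open_Times) auto
    ultimately have H: "((\<lambda>(x, y). H x y) has_derivative (\<lambda>(s, t). s *\<^sub>R a + t *\<^sub>R b))
        (at (Re z, Im z))"
      unfolding b_def by (simp only: blinfun_scaleR_left.rep_eq)
    have "((\<lambda>w. (Re w, Im w)) has_derivative (\<lambda>w. (Re w, Im w))) (at z)"
      by (intro derivative_intros)
    from has_derivative_compose [OF this H]
    have "((\<lambda>w. h (slice_embed I w)) has_derivative (\<lambda>w. Re w *\<^sub>R a + Im w *\<^sub>R b)) (at z)"
      by (simp add: H_def slice_embed_def)
    then have "((\<lambda>w. ?\<phi> (h (slice_embed I w))) has_derivative
        (\<lambda>w. ?\<phi> (Re w *\<^sub>R a + Im w *\<^sub>R b))) (at z)"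
      by (rule bounded_linear.has_derivative [OF bounded_linear_slice_functional])
    \<comment> \<open>Since \<open>a = - (I * b)\<close>, the functional satisfies
      \<open>?\<phi> b = \<i> * ?\<phi> a\<close>, and \<open>?\<phi> a\<close> factors out.\<close>
    moreover have "?\<phi> (Re w *\<^sub>R a + Im w *\<^sub>R b) = ?\<phi> a * w" for w
    proof -
      interpret bounded_linear ?\<phi>
        by (rule bounded_linear_slice_functional)
      have "a = - (I * b)"
        using cr [OF z] by (simp add: a_def b_def eq_neg_iff_add_eq_0)
      then have "?\<phi> a = - (\<i> * ?\<phi> b)"
        by (simp add: neg slice_functional_unit_mult [OF I])
      then show ?thesis
        by (simp add: add scaleR complex_eq_iff algebra_simps)
    qed
    ultimately show ?thesis
      by (auto simp: has_field_derivative_def)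
  qed
  then show ?thesis
    using open_vimage_slice_embed [OF U]
    by (auto simp: holomorphic_on_open)
qed

text \<open>Pulled back by the isometry \<open>slice_embed I\<close>, the zeros accumulate at the
  centre of a disc, where the classical identity theorem applies to each functional of
  \<open>h\<close>.\<close>

lemma slice_identity_local:
  assumes I: "I \<in> imag_units" and U: "openin (top_of_set (slice_plane I)) U"
    and h: "slice_holomorphic_on I h U"
    and p: "p \<in> U" and lim: "p islimpt {q \<in> U. h q = 0}"
  shows "\<exists>e>0. \<forall>q \<in> slice_plane I \<inter> ball p e. h q = 0"
proof -
  have "U \<subseteq> slice_plane I"
    using openin_imp_subset [OF U] .
  then obtain c where c: "p = slice_embed I c"
    using p by (auto simp: slice_plane_eq_range)
  obtain e where e: "0 < e" "ball c e \<subseteq> slice_embed I -` U"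
    using openE [OF open_vimage_slice_embed [OF U], of c] p c by auto
  define Z where "Z = {z \<in> ball c e. h (slice_embed I z) = 0}"
  have "c islimpt Z"
    unfolding islimpt_approachable
  proof (intro allI impI)
    fix d :: real assume "0 < d"
    then have "0 < min d e"
      using e(1) by simp
    then obtain q where q: "q \<in> U" "h q = 0" "q \<noteq> p" "dist q p < min d e"
      using lim unfolding islimpt_approachable by blast
    then obtain w where "q = slice_embed I w"
      using \<open>U \<subseteq> slice_plane I\<close> by (auto simp: slice_plane_eq_range)
    with q c show "\<exists>z\<in>Z. z \<noteq> c \<and> dist z c < d"
      by (intro bexI [of _ w]) (auto simp: Z_def dist_slice_embed [OF I] dist_commute)
  qed
  have zero: "h (slice_embed I z) = 0" if "z \<in> ball c e" for z
  proof -
    \<comment> \<open>The functional is taken along the value of \<open>h\<close> itself: its real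
      part there is the squared norm of \<open>?v\<close>, so its vanishing forces
      \<open>?v = 0\<close>.\<close>
    let ?v = "h (slice_embed I z)"
    have "slice_functional I ?v (h (slice_embed I z)) = 0"
    proof (rule analytic_continuation
        [where S = "ball c e" and U = Z and \<xi> = c
          and f = "\<lambda>w. slice_functional I ?v (h (slice_embed I w))"])
      show "(\<lambda>w. slice_functional I ?v (h (slice_embed I w))) holomorphic_on ball c e"
        using holomorphic_on_slice_functional [OF I U h] e(2) by (rule holomorphic_on_subset)
      show "c islimpt Z"
        by fact
      show "slice_functional I ?v (h (slice_embed I w)) = 0" if "w \<in> Z" for w
        using that by (simp add: Z_def slice_functional_def complex_eq_iff)
    qed (use that e in \<open>auto simp: Z_def\<close>)
    then show ?thesis
      by (simp add: slice_functional_def complex_eq_iff)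
  qed
  have "h q = 0" if "q \<in> slice_plane I \<inter> ball p e" for q
    using that zero c by (auto simp: slice_plane_eq_range dist_slice_embed [OF I])
  with e(1) show ?thesis
    by blast
qed

section \<open>Passing between slices\<close>

lemma slice_openD:
  "slice_open \<Omega> \<Longrightarrow> I \<in> imag_units \<Longrightarrow> openin (top_of_set (slice_plane I)) (\<Omega> \<inter> slice_plane I)"
  by (simp add: slice_open_def)

lemma slice_openI:
  assumes "\<And>I q. I \<in> imag_units \<Longrightarrow> q \<in> S \<Longrightarrow> q \<in> slice_plane I \<Longrightarrow>
    \<exists>e>0. \<forall>z \<in> slice_plane I \<inter> ball q e. z \<in> S"
  shows "slice_open S"
  unfolding slice_open_def openin_contains_ball using assms by blast

lemma slice_open_contains_ball:
  assumes "slice_open S" "I \<in> imag_units" "q \<in> S" "q \<in> slice_plane I"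
  obtains e where "0 < e" "slice_plane I \<inter> ball q e \<subseteq> S"
  using slice_openD [OF assms(1,2)] assms(3,4) unfolding openin_contains_ball by blast

text \<open>For slice regular \<open>h\<close> on \<Omega>, this is the interior of the zero set of
  \<open>h\<close> in \<Omega> for the slice topology. At a real point the radius may depend on the
  slice.\<close>

definition slice_zero_interior :: "(quat \<Rightarrow> quat) \<Rightarrow> quat set \<Rightarrow> quat set"
  where "slice_zero_interior h \<Omega> = {q \<in> \<Omega>. \<forall>J\<in>imag_units. q \<in> slice_plane J \<longrightarrow>
    (\<exists>e>0. \<forall>z \<in> slice_plane J \<inter> ball q e. h z = 0)}"

text \<open>The local identity theorem in the slice of \<open>I\<close> makes \<open>h\<close>
  vanish near \<open>q\<close> there. A nonreal \<open>q\<close> lies in no other slice plane; for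
  real \<open>q\<close> the zeros on the real axis feed the local theorem in every other
  slice.\<close>

lemma slice_zero_interiorI:
  assumes h: "slice_regular_on h \<Omega>" and I: "I \<in> imag_units"
    and q: "q \<in> \<Omega>" "q \<in> slice_plane I"
    and lim: "q islimpt {z \<in> \<Omega> \<inter> slice_plane I. h z = 0}"
  shows "q \<in> slice_zero_interior h \<Omega>"
proof -
  have \<Omega>: "slice_open \<Omega>" and hol: "\<And>J. J \<in> imag_units \<Longrightarrow> slice_holomorphic_on J h (\<Omega> \<inter> slice_plane J)"
    using h by (auto simp: slice_regular_on_def)
  obtain e where e: "0 < e" "\<forall>z \<in> slice_plane I \<inter> ball q e. h z = 0"
    using slice_identity_local [OF I slice_openD [OF \<Omega> I] hol [OF I] _ lim] q by blast
  have "\<exists>e>0. \<forall>z \<in> slice_plane J \<inter> ball q e. h z = 0"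
    if J: "J \<in> imag_units" and qJ: "q \<in> slice_plane J" for J
  proof (cases "q \<in> \<real>")
    case False
    then show ?thesis
      using slice_plane_eq_if_common_nonreal [OF I J q(2) qJ] e by auto
  next
    case True
    obtain d where d: "0 < d" "slice_plane J \<inter> ball q d \<subseteq> \<Omega>"
      using slice_open_contains_ball [OF \<Omega> J q(1) qJ] .
    \<comment> \<open>Short real shifts of \<open>q\<close> lie in both slices: the radius
      \<open>e\<close> makes them zeros of \<open>h\<close>, the radius \<open>d\<close> keeps them
      in \<Omega>.\<close>
    have "q islimpt {z \<in> \<Omega> \<inter> slice_plane J. h z = 0}"
    proof (rule islimpt_of_real_shifts)
      show "0 < min d e"
        using d e by simp
      fix t :: real assume t: "\<bar>t\<bar> < min d e"
      have "q + of_real t \<in> slice_plane K" if "q \<in> slice_plane K" for K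
        using that by (rule add_of_real_mem_slice_plane)
      with t d e q qJ show "q + of_real t \<in> {z \<in> \<Omega> \<inter> slice_plane J. h z = 0}"
        by (auto simp: dist_norm)
    qed
    then show ?thesis
      using slice_identity_local [OF J slice_openD [OF \<Omega> J] hol [OF J]] q qJ by blast
  qed
  with q show ?thesis
    by (auto simp: slice_zero_interior_def)
qed

lemma slice_zero_interior_eq_0:
  assumes "q \<in> slice_zero_interior h \<Omega>" "J \<in> imag_units" "q \<in> slice_plane J"
  shows "h q = 0"
  using assms unfolding slice_zero_interior_def by force

text \<open>Vanishing near \<open>q\<close> in one slice does not settle the other slices through a
  nearby point \<open>z\<close>, which may be real even if \<open>q\<close> is not. Zeros at short
  real shifts of \<open>z\<close> supply the accumulation needed by
  \<open>slice_zero_interiorI\<close>.\<close>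

lemma slice_open_slice_zero_interior:
  assumes h: "slice_regular_on h \<Omega>"
  shows "slice_open (slice_zero_interior h \<Omega>)"
proof (rule slice_openI)
  fix I q
  assume I: "I \<in> imag_units" and q: "q \<in> slice_zero_interior h \<Omega>" "q \<in> slice_plane I"
  have "q \<in> \<Omega>"
    using q by (simp add: slice_zero_interior_def)
  moreover have "slice_open \<Omega>"
    using h by (simp add: slice_regular_on_def)
  ultimately obtain d where d: "0 < d" "slice_plane I \<inter> ball q d \<subseteq> \<Omega>"
    using slice_open_contains_ball I q by metis
  obtain e where e: "0 < e" "\<forall>z \<in> slice_plane I \<inter> ball q e. h z = 0"
    using q I by (auto simp: slice_zero_interior_def)
  have "z \<in> slice_zero_interior h \<Omega>" if z: "z \<in> slice_plane I \<inter> ball q (min d e)" for z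
  proof (rule slice_zero_interiorI [OF h I])
    show "z \<in> \<Omega>" "z \<in> slice_plane I"
      using z d by auto
    show "z islimpt {z \<in> \<Omega> \<inter> slice_plane I. h z = 0}"
    proof (rule islimpt_of_real_shifts)
      \<comment> \<open>This is the room left around \<open>z\<close> inside both balls about
        \<open>q\<close>.\<close>
      show "0 < min d e - dist q z"
        using z by simp
      fix t :: real assume "\<bar>t\<bar> < min d e - dist q z"
      moreover have "dist q (z + of_real t) \<le> dist q z + \<bar>t\<bar>"
        using dist_triangle [of q "z + of_real t" z] by (simp add: dist_norm)
      ultimately have "z + of_real t \<in> ball q d \<inter> ball q e"
        unfolding Int_iff mem_ball by linarith
      then show "z + of_real t \<in> {z \<in> \<Omega> \<inter> slice_plane I. h z = 0}"
        using d e z add_of_real_mem_slice_plane [of z I t] by auto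
    qed
  qed
  then show "\<exists>e>0. \<forall>z \<in> slice_plane I \<inter> ball q e. z \<in> slice_zero_interior h \<Omega>"
    using d e by (intro exI [of _ "min d e"]) auto
qed

text \<open>At a point \<open>q\<close> outside \<open>slice_zero_interior h \<Omega>\<close>, zeros
  of \<open>h\<close> cannot accumulate within any slice through \<open>q\<close>. So near
  \<open>q\<close> in such a slice only \<open>q\<close> itself can be a zero, and \<open>q\<close>
  is outside by assumption.\<close>

lemma slice_open_minus_slice_zero_interior:
  assumes h: "slice_regular_on h \<Omega>"
  shows "slice_open (\<Omega> - slice_zero_interior h \<Omega>)"
proof (rule slice_openI)
  fix I q
  assume I: "I \<in> imag_units" and q: "q \<in> \<Omega> - slice_zero_interior h \<Omega>" "q \<in> slice_plane I"
  have "slice_open \<Omega>"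
    using h by (simp add: slice_regular_on_def)
  then obtain d where d: "0 < d" "slice_plane I \<inter> ball q d \<subseteq> \<Omega>"
    using slice_open_contains_ball I q by (metis DiffD1)
  have "\<not> q islimpt {z \<in> \<Omega> \<inter> slice_plane I. h z = 0}"
    using slice_zero_interiorI [OF h I] q by blast
  then obtain e where e: "0 < e"
    "\<And>z. z \<in> \<Omega> \<Longrightarrow> z \<in> slice_plane I \<Longrightarrow> h z = 0 \<Longrightarrow> dist z q < e \<Longrightarrow> z = q"
    unfolding islimpt_approachable by blast
  have "z \<in> \<Omega> - slice_zero_interior h \<Omega>" if z: "z \<in> slice_plane I \<inter> ball q (min d e)" for z
  proof -
    have "z \<in> \<Omega>"
      using z d by auto
    moreover have "z \<notin> slice_zero_interior h \<Omega>"
    proof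
      assume "z \<in> slice_zero_interior h \<Omega>"
      moreover from this have "h z = 0"
        using slice_zero_interior_eq_0 I z by blast
      ultimately show False
        using e(2) [of z] z q \<open>z \<in> \<Omega>\<close> by (auto simp: dist_commute)
    qed
    ultimately show ?thesis
      by blast
  qed
  then show "\<exists>e>0. \<forall>z \<in> slice_plane I \<inter> ball q e. z \<in> \<Omega> - slice_zero_interior h \<Omega>"
    using d e by (intro exI [of _ "min d e"]) auto
qed

theorem theorem2p10:
  fixes \<Omega> :: "quat set" and f g :: "quat \<Rightarrow> quat"
  assumes "st_domain \<Omega>"
    and "slice_regular_on f \<Omega>" and "slice_regular_on g \<Omega>"
    and "\<exists>I\<in>imag_units. \<exists>A \<subseteq> \<Omega> \<inter> slice_plane I.
      (\<exists>p \<in> \<Omega> \<inter> slice_plane I. p islimpt A) \<and> (\<forall>q\<in>A. f q = g q)"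
  shows "\<forall>q\<in>\<Omega>. f q = g q"
proof -
  define h where "h = (\<lambda>q. f q - g q)"
  define Z where "Z = slice_zero_interior h \<Omega>"
  have h: "slice_regular_on h \<Omega>"
    using assms(2,3) by (auto simp: slice_regular_on_def h_def intro: slice_holomorphic_on_diff)
  obtain I A p where I: "I \<in> imag_units" and A: "A \<subseteq> \<Omega> \<inter> slice_plane I" "\<forall>q\<in>A. f q = g q"
    and p: "p \<in> \<Omega>" "p \<in> slice_plane I" "p islimpt A"
    using assms(4) by blast
  have "A \<subseteq> {z \<in> \<Omega> \<inter> slice_plane I. h z = 0}"
    using A by (auto simp: h_def)
  then have "p \<in> Z"
    unfolding Z_def using slice_zero_interiorI [OF h I p(1,2)] islimpt_subset p(3) by blast
  moreover have "Z \<subseteq> \<Omega>"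
    by (auto simp: Z_def slice_zero_interior_def)
  moreover have "openin slice_topology Z" "openin slice_topology (\<Omega> - Z)"
    using slice_open_slice_zero_interior [OF h] slice_open_minus_slice_zero_interior [OF h]
    by (auto simp: openin_slice_topology Z_def)
  moreover have "connectedin slice_topology \<Omega>"
    using assms(1) by (simp add: st_domain_def)
  \<comment> \<open>The slice-open sets \<open>Z\<close> and \<open>\<Omega> - Z\<close> partition
    the connected set \<Omega>, and \<open>p\<close> lies in the first.\<close>
  ultimately have "\<Omega> - Z = {}"
    unfolding connectedin by blast
  \<comment> \<open>Membership in \<open>Z\<close> speaks only of slices through \<open>q\<close>,
    so one such slice has to be exhibited.\<close>
  then have "h q = 0" if "q \<in> \<Omega>" for q
    using that quat_in_some_slice_plane [of q] slice_zero_interior_eq_0 unfolding Z_def by blast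
  then show ?thesis
    by (simp add: h_def)
qed

end
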